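(* Let $d\geq\gamma\geq 0$ be integers. Then $k(d,\gamma)\geq \lfloor (d-\gamma+1)/2\rfloor$.
   Context: A graph $G=(V,E)$ is $k$-linked if $|V|\geq 2k$ and for every choice of $2k$ distinct vertices $s_1,\dots,s_k,t_1,\dots,t_k$ there exist $k$ pairwise vertex-disjoint paths $L_1,\dots,L_k$ with $L_i$ joining $s_i$ and $t_i$; a polytope is $k$-linked if its graph (vertices and edges) is. For a polytope $P$, $k(P)=\max\{k : P \text{ is } k\text{-linked}\}$. For $d,\gamma\geq 0$ let $\mathcal{P}_d^\gamma$ be the class of $d$-polytopes with $d+\gamma+1$ vertices, and $k(d,\gamma)=\max\{k : k(P)\geq k \text{ for all } P\in\mathcal{P}_d^\gamma\}$. *)

theory Defs
  imports "HOL-Analysis.Analysis" "HOL-Library.Extended_Nat"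
begin

text \<open>A graph is given by its vertex set and its set of edges, each edge being
  the set of its two ends.\<close>

definition is_path :: "'a set \<Rightarrow> 'a set set \<Rightarrow> 'a list \<Rightarrow> bool" where
  "is_path V E p \<longleftrightarrow> p \<noteq> [] \<and> set p \<subseteq> V \<and> distinct p \<and>
     (\<forall>i. Suc i < length p \<longrightarrow> {p ! i, p ! Suc i} \<in> E)"

definition graph_linked :: "nat \<Rightarrow> 'a set \<Rightarrow> 'a set set \<Rightarrow> bool" where
  "graph_linked k V E \<longleftrightarrow> 2 * k \<le> card V \<and>
     (\<forall>s t. s ` {..<k} \<subseteq> V \<and> t ` {..<k} \<subseteq> V \<and>
            inj_on s {..<k} \<and> inj_on t {..<k} \<and> s ` {..<k} \<inter> t ` {..<k} = {} \<longrightarrow>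
        (\<exists>L :: nat \<Rightarrow> 'a list.
           (\<forall>i<k. is_path V E (L i) \<and> hd (L i) = s i \<and> last (L i) = t i) \<and>
           (\<forall>i<k. \<forall>j<k. i \<noteq> j \<longrightarrow> set (L i) \<inter> set (L j) = {})))"

definition vertices :: "'a::euclidean_space set \<Rightarrow> 'a set" where
  "vertices P = {v. v extreme_point_of P}"

text \<open>A one-dimensional face of a polytope is the segment between two distinct
  vertices; \<open>edge_of\<close> requires dimension 1, so \<open>u \<noteq> v\<close> below.\<close>

definition edges :: "'a::euclidean_space set \<Rightarrow> 'a set set" where
  "edges P = {{u, v} | u v. closed_segment u v edge_of P}"

definition polytope_linked :: "nat \<Rightarrow> 'a::euclidean_space set \<Rightarrow> bool" where
  "polytope_linked k P \<longleftrightarrow> graph_linked k (vertices P) (edges P)"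

definition linkedness :: "'a::euclidean_space set \<Rightarrow> nat" where
  "linkedness P = Max {k. polytope_linked k P}"

definition polytope_class :: "nat \<Rightarrow> nat \<Rightarrow> 'a::euclidean_space set set" where
  "polytope_class d g =
     {P. polytope P \<and> aff_dim P = int d \<and> card (vertices P) = d + g + 1}"

text \<open>The number \<open>k(d, g)\<close>, taken over the polytopes in the ambient space \<open>'a\<close>.
  The supremum in \<^typ>\<open>enat\<close> is the maximum whenever the class is nonempty (see
  \<open>class_linkedness_eq_Max\<close> below), and it is \<open>\<infinity>\<close> for an empty class, where
  no maximum exists: for example the 1-polytopes with three vertices, or any class with
  \<open>d > DIM('a)\<close>.\<close>

definition class_linkedness :: "'a::euclidean_space itself \<Rightarrow> nat \<Rightarrow> nat \<Rightarrow> enat" where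
  "class_linkedness T d g =
     Sup {enat k | k. \<forall>P \<in> (polytope_class d g :: 'a set set). k \<le> linkedness P}"

lemma linkedness_set:
  shows finite_linked: "finite {k. polytope_linked k P}"
    and polytope_linked_0: "polytope_linked 0 P"
proof -
  have "{k. polytope_linked k P} \<subseteq> {..card (vertices P)}"
    by (auto simp: polytope_linked_def graph_linked_def)
  then show "finite {k. polytope_linked k P}"
    using finite_subset by blast
  show "polytope_linked 0 P"
    by (simp add: polytope_linked_def graph_linked_def)
qed

lemma class_linkedness_eq_Max:
  assumes "(polytope_class d g :: 'a::euclidean_space set set) \<noteq> {}"
  defines "K \<equiv> {k. \<forall>P \<in> (polytope_class d g :: 'a set set). k \<le> linkedness P}"
  shows "finite K" "K \<noteq> {}" "class_linkedness TYPE('a) d g = enat (Max K)"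
proof -
  obtain P :: "'a set" where P: "P \<in> polytope_class d g"
    using assms(1) by blast
  then have "K \<subseteq> {..linkedness P}"
    by (auto simp: K_def)
  then show fin: "finite K"
    using finite_subset by blast
  have "0 \<in> K"
    by (simp add: K_def)
  then show ne: "K \<noteq> {}"
    by blast
  have "class_linkedness TYPE('a) d g = Sup (enat ` K)"
    unfolding class_linkedness_def K_def by (rule arg_cong[where f = Sup]) auto
  also have "\<dots> = enat (Max K)"
  proof (rule antisym)
    show "Sup (enat ` K) \<le> enat (Max K)"
      using fin by (auto intro!: Sup_least)
    show "enat (Max K) \<le> Sup (enat ` K)"
      using Max_in[OF fin ne] by (intro Sup_upper imageI)
  qed
  finally show "class_linkedness TYPE('a) d g = enat (Max K)" .
qed

end

theory Submission imports Defs begin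

text \<open>The graph of a \<open>d\<close>-polytope has minimum degree at least \<open>d\<close>, so with only
  \<open>d + 1\<close> vertices it is complete. Otherwise some facet misses at least two of the
  \<open>n\<close> vertices. By the degree bound, the terminals outside such a facet can be joined, by
  disjoint edges, to their own partners or to distinct nonterminal vertices of the facet, as
  long as \<open>n\<close> plus the number of terminals is at most \<open>2 d + 2\<close>. This inequality
  is inherited by the facet, so induction on the dimension applies. For the induction, pairs
  of equal terminals are allowed: they are what remains in the facet of a terminal outside
  that is adjacent to its partner.\<close>

section \<open>Linking through a subgraph\<close>

text \<open>Only terminals with different indices must differ. An arbitrary index set lets pairs
  that are already joined be dropped without renumbering the others.\<close>

definition disjoint_pairs :: "'a set \<Rightarrow> 'i set \<Rightarrow> ('i \<Rightarrow> 'a) \<Rightarrow> ('i \<Rightarrow> 'a) \<Rightarrow> bool" where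
  "disjoint_pairs V I s t \<longleftrightarrow> (\<forall>i\<in>I. s i \<in> V \<and> t i \<in> V) \<and>
     (\<forall>i\<in>I. \<forall>j\<in>I. i \<noteq> j \<longrightarrow> {s i, t i} \<inter> {s j, t j} = {})"

definition linked_pairs ::
    "'a set \<Rightarrow> 'a set set \<Rightarrow> 'i set \<Rightarrow> ('i \<Rightarrow> 'a) \<Rightarrow> ('i \<Rightarrow> 'a) \<Rightarrow> bool" where
  "linked_pairs V E I s t \<longleftrightarrow> (\<exists>L.
     (\<forall>i\<in>I. is_path V E (L i) \<and> hd (L i) = s i \<and> last (L i) = t i) \<and>
     (\<forall>i\<in>I. \<forall>j\<in>I. i \<noteq> j \<longrightarrow> set (L i) \<inter> set (L j) = {}))"

section \<open>Extending paths and choosing distinct representatives\<close>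

lemma is_path_mono: "is_path W F p \<Longrightarrow> W \<subseteq> V \<Longrightarrow> F \<subseteq> E \<Longrightarrow> is_path V E p"
  unfolding is_path_def by blast

lemma is_path_singleton: "x \<in> V \<Longrightarrow> is_path V E [x]"
  by (simp add: is_path_def)

lemma is_path_Cons:
  assumes "is_path V E p" "x \<in> V" "x \<notin> set p" "{x, hd p} \<in> E"
  shows "is_path V E (x # p)"
  unfolding is_path_def
proof (intro conjI allI impI)
  fix i assume "Suc i < length (x # p)"
  then show "{(x # p) ! i, (x # p) ! Suc i} \<in> E"
    using assms by (cases i) (auto simp: is_path_def hd_conv_nth)
qed (use assms in \<open>auto simp: is_path_def\<close>)

lemma is_path_snoc:
  assumes "is_path V E p" "x \<in> V" "x \<notin> set p" "{x, last p} \<in> E"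
  shows "is_path V E (p @ [x])"
  unfolding is_path_def
proof (intro conjI allI impI)
  fix i assume i: "Suc i < length (p @ [x])"
  show "{(p @ [x]) ! i, (p @ [x]) ! Suc i} \<in> E"
  proof (cases "Suc i < length p")
    case True
    then show ?thesis using assms by (auto simp: is_path_def nth_append)
  next
    case False
    then have "i = length p - 1" "p \<noteq> []" "Suc i = length p"
      using i assms(1) by (auto simp: is_path_def)
    then show ?thesis
      using assms(4) by (simp add: nth_append last_conv_nth insert_commute)
  qed
qed (use assms in \<open>auto simp: is_path_def\<close>)

text \<open>A greedy choice suffices in place of Hall's condition: the values already chosen number
  fewer than \<open>card A\<close>, so they never exhaust the next set \<open>G x\<close>.\<close>

lemma distinct_representatives:
  assumes "finite A" "\<And>x. x \<in> A \<Longrightarrow> finite (G x) \<and> card A \<le> card (G x)"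
  shows "\<exists>f. inj_on f A \<and> (\<forall>x\<in>A. f x \<in> G x)"
  using assms
proof (induction A rule: finite_induct)
  case (insert a A)
  have "finite (G x) \<and> card A \<le> card (G x)" if "x \<in> A" for x
    using insert.prems[of x] insert.hyps that by simp
  then obtain f where f: "inj_on f A" "\<forall>x\<in>A. f x \<in> G x"
    using insert.IH by blast
  have "card (f ` A) < card (G a)"
    using insert.prems[of a] insert.hyps card_image_le[of A f] by simp
  then obtain b where b: "b \<in> G a" "b \<notin> f ` A"
    using insert.hyps by (metis card_mono finite_imageI not_less subsetI)
  have fb: "(f(a := b)) x = f x" if "x \<in> A" for x
    using insert.hyps that by auto
  have "inj_on (f(a := b)) (insert a A)"
    using f(1) b(2) insert.hyps(2) unfolding inj_on_def by auto
  moreover have "\<forall>x\<in>insert a A. (f(a := b)) x \<in> G x"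
    using f(2) b(1) fb by auto
  ultimately show ?case by blast
qed simp

lemma linked_pairs_adjacent:
  assumes "disjoint_pairs V I s t" "\<And>i. i \<in> I \<Longrightarrow> s i = t i \<or> {s i, t i} \<in> E"
  shows "linked_pairs V E I s t"
proof -
  let ?L = "\<lambda>i. if s i = t i then [s i] else [s i, t i]"
  have "is_path V E (?L i)" if "i \<in> I" for i
    using that assms(1) assms(2)[OF that]
    by (auto simp: disjoint_pairs_def intro!: is_path_Cons is_path_singleton)
  then show ?thesis
    using assms(1) unfolding linked_pairs_def disjoint_pairs_def by (intro exI[of _ ?L]) auto
qed

section \<open>Moving terminals into a subgraph\<close>

text \<open>Each pair is either joined directly outside \<open>W\<close> or replaced by a pair
  inside \<open>W\<close>, and the linkage of the new pairs in \<open>W\<close> is prolonged by the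
  moving edges. The bound in \<open>sub\<close> records that moving creates no additional terminals,
  so that an induction hypothesis can be supplied there.\<close>

lemma linked_pairs_via_subgraph:
  fixes E F :: "'a set set" and s t :: "'i \<Rightarrow> 'a"
  assumes V: "finite V" and W: "W \<subseteq> V" and F: "F \<subseteq> E"
    and deg: "\<And>v. v \<in> V \<Longrightarrow> d \<le> card {w \<in> V - {v}. {v, w} \<in> E}"
    and few: "card V + card (s ` I \<union> t ` I) \<le> 2 * d + 2"
    and dW: "d \<le> card W"
    and st: "disjoint_pairs V I s t"
    and sub: "\<And>(J :: 'i set) s' t'. disjoint_pairs W J s' t' \<Longrightarrow>
        card (s' ` J \<union> t' ` J) \<le> card (s ` I \<union> t ` I) \<Longrightarrow> linked_pairs W F J s' t'"
  shows "linked_pairs V E I s t"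
proof -
  define T where "T = s ` I \<union> t ` I"
  \<comment> \<open>The pairs in \<open>D\<close> lie wholly outside \<open>W\<close> and are joined
    by an edge or a single vertex, so they avoid the subgraph altogether.\<close>
  define D where "D = {i \<in> I. s i \<notin> W \<and> t i \<notin> W \<and> (s i = t i \<or> {s i, t i} \<in> E)}"
  define J where "J = I - D"
  \<comment> \<open>A terminal \<open>x\<close> outside \<open>W\<close> is stuck if it cannot move
    onto its own partner \<open>y\<close>. The stuck terminals of the remaining pairs form
    \<open>A\<close>; each needs a fresh vertex, and \<open>G x\<close> holds the
    candidates.\<close>
  define stuck where "stuck x y \<longleftrightarrow> x \<notin> W \<and> \<not> (y \<in> W \<and> {x, y} \<in> E)" for x y
  define A where "A = {s i |i. i \<in> J \<and> stuck (s i) (t i)} \<union> {t i |i. i \<in> J \<and> stuck (t i) (s i)}"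
  define G where "G x = {w \<in> W - T. {x, w} \<in> E}" for x
  have stV: "s i \<in> V" "t i \<in> V" if "i \<in> I" for i
    using st that by (auto simp: disjoint_pairs_def)
  have apart: "s i \<noteq> s j" "s i \<noteq> t j" "t i \<noteq> s j" "t i \<noteq> t j" if "i \<in> I" "j \<in> I" "i \<noteq> j" for i j
    using st that by (auto simp: disjoint_pairs_def)
  have TV: "T \<subseteq> V" using stV by (auto simp: T_def)
  have finT: "finite T" using TV V finite_subset by blast
  have finW: "finite W" using W V finite_subset by blast
  have JI: "J \<subseteq> I" by (auto simp: J_def)
  have AT: "A \<subseteq> T - W" using JI by (auto simp: A_def T_def stuck_def)
  have finA: "finite A" using AT finT finite_subset by blast
  \<comment> \<open>If the partner lies in \<open>W\<close>, it differs from \<open>x\<close>, and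
    being stuck excludes the edge. If it lies outside \<open>W\<close>, equality or adjacency would
    have put the pair into \<open>D\<close>.\<close>
  have partner: "\<exists>y\<in>T. y \<noteq> x \<and> {x, y} \<notin> E" if "x \<in> A" for x
  proof -
    obtain i where i: "i \<in> J" "x = s i \<and> stuck (s i) (t i) \<or> x = t i \<and> stuck (t i) (s i)"
      using \<open>x \<in> A\<close> unfolding A_def by blast
    define y where "y = (if x = s i then t i else s i)"
    have y: "{x, y} = {s i, t i}" "x \<notin> W" "\<not> (y \<in> W \<and> {x, y} \<in> E)"
      using i(2) by (auto simp: y_def stuck_def insert_commute)
    have "{x, y} \<notin> E \<and> x \<noteq> y"
    proof (cases "y \<in> W")
      case False
      then have "s i \<notin> W" "t i \<notin> W" using y(1,2) by (auto simp: doubleton_eq_iff)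
      then have "s i \<noteq> t i" "{s i, t i} \<notin> E"
        using i(1) by (auto simp: J_def D_def)
      then show ?thesis using y(1) by (auto simp: doubleton_eq_iff insert_commute)
    qed (use y in auto)
    moreover have "y \<in> T" using i(1) JI by (auto simp: y_def T_def)
    ultimately show ?thesis by metis
  qed
  have "card A \<le> card (G x)" if x: "x \<in> A" for x
  proof -
    obtain y where y: "y \<in> T" "y \<noteq> x" "{x, y} \<notin> E"
      using partner[OF x] by blast
    \<comment> \<open>Neighbours of \<open>x\<close> that are not in \<open>G x\<close> lie in
      \<open>B\<close>, while \<open>x\<close> and \<open>y\<close> lie in \<open>B\<close> without
      being neighbours of \<open>x\<close>. Hence \<open>d + 2 <= card (G x) + card B\<close>, where
      \<open>card B = card V - card W + card (W Int T)\<close>. With \<open>d <= card W\<close> and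
      \<open>card V + card T <= 2 * d + 2\<close> this gives
      \<open>card (G x) >= card (T - W) >= card A\<close>.\<close>
    define B where "B = (V - W) \<union> (W \<inter> T)"
    have xT: "x \<in> T" "x \<notin> W" using x AT by auto
    have finB: "finite B" using V finW by (auto simp: B_def)
    have xyB: "{x, y} \<subseteq> B" using xT y TV by (auto simp: B_def)
    have "{w \<in> V - {x}. {x, w} \<in> E} \<subseteq> G x \<union> (B - {x, y})"
      using y by (auto simp: G_def B_def)
    then have "card {w \<in> V - {x}. {x, w} \<in> E} \<le> card (G x \<union> (B - {x, y}))"
      using finB finW by (intro card_mono) (auto simp: G_def)
    also have "\<dots> \<le> card (G x) + card (B - {x, y})"
      by (rule card_Un_le)
    also have "card (B - {x, y}) = card B - 2"
      using xyB y finB by (subst card_Diff_subset) auto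
    finally have 1: "d \<le> card (G x) + (card B - 2)"
      using deg[of x] xT TV by force
    have 2: "2 \<le> card B"
      using card_mono[OF finB xyB] y(2) by simp
    have 3: "card B = card V - card W + card (W \<inter> T)"
      unfolding B_def using V finW W
      by (subst card_Un_disjoint) (auto simp: card_Diff_subset)
    have 4: "card T = card (W \<inter> T) + card (T - W)"
      using finT by (metis Int_commute card_Int_Diff)
    have 5: "card W \<le> card V" using W V card_mono by blast
    have 6: "card A \<le> card (T - W)" using AT finT by (simp add: card_mono)
    show ?thesis
      using 1 2 3 4 5 6 few dW unfolding T_def[symmetric] by linarith
  qed
  then obtain f where f: "inj_on f A" "\<forall>x\<in>A. f x \<in> G x"
    using distinct_representatives[of A G] finA finW by (auto simp: G_def)
  \<comment> \<open>In the second case both ends of the pair become \<open>y\<close>, which produces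
    a pair of equal terminals in \<open>W\<close>.\<close>
  define move where
    "move x y = (if x \<in> W then x else if y \<in> W \<and> {x, y} \<in> E then y else f x)" for x y
  define s' where "s' i = move (s i) (t i)" for i
  define t' where "t' i = move (t i) (s i)" for i
  have s'_cases: "s' i \<in> {s i, t i} \<inter> W \<or> s i \<in> A \<and> s' i = f (s i)" if "i \<in> J" for i
    using that by (auto simp: s'_def move_def A_def stuck_def)
  have t'_cases: "t' i \<in> {s i, t i} \<inter> W \<or> t i \<in> A \<and> t' i = f (t i)" if "i \<in> J" for i
    using that by (auto simp: t'_def move_def A_def stuck_def)
  have fA: "f x \<in> W" "f x \<notin> T" "{x, f x} \<in> E" if "x \<in> A" for x
    using f(2) that by (auto simp: G_def)
  have stT: "s i \<in> T" "t i \<in> T" if "i \<in> J" for i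
    using that JI by (auto simp: T_def)
  have f_eq: "f x = f y \<longleftrightarrow> x = y" if "x \<in> A" "y \<in> A" for x y
    using f(1) that by (auto simp: inj_on_def)
  have "disjoint_pairs W J s' t'"
    unfolding disjoint_pairs_def
  proof (intro conjI ballI impI)
    fix i j assume ij: "i \<in> J" "j \<in> J" "i \<noteq> j"
    have ap: "s i \<noteq> s j" "s i \<noteq> t j" "t i \<noteq> s j" "t i \<noteq> t j"
      using apart[of i j] ij JI by blast+
    \<comment> \<open>A new terminal is an old terminal of the same pair or the
      \<open>f\<close>-image of one. Old terminals of different pairs differ, \<open>f\<close> is
      injective on \<open>A\<close>, and its values avoid \<open>T\<close>, so no mixture of the two
      kinds collides.\<close>
    have d: "p \<noteq> q"
      if "p \<in> {s i, t i} \<inter> W \<or> (\<exists>x\<in>{s i, t i} \<inter> A. p = f x)"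
         "q \<in> {s j, t j} \<inter> W \<or> (\<exists>x\<in>{s j, t j} \<inter> A. q = f x)" for p q
      using that ap stT[OF ij(1)] stT[OF ij(2)] fA(2) f_eq by (auto; metis)
    show "{s' i, t' i} \<inter> {s' j, t' j} = {}"
      using d s'_cases[OF ij(1)] t'_cases[OF ij(1)] s'_cases[OF ij(2)] t'_cases[OF ij(2)]
      by blast
  next
    fix i assume i: "i \<in> J"
    show "s' i \<in> W" using s'_cases[OF i] fA(1) by auto
    show "t' i \<in> W" using t'_cases[OF i] fA(1) by auto
  qed
  moreover have "card (s' ` J \<union> t' ` J) \<le> card T"
  proof -
    \<comment> \<open>Terminals in \<open>W\<close> may be kept, and each fresh vertex is charged to
      a different terminal outside \<open>W\<close>.\<close>
    have "s' ` J \<union> t' ` J \<subseteq> (T \<inter> W) \<union> f ` A"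
    proof -
      have "s' i \<in> (T \<inter> W) \<union> f ` A" "t' i \<in> (T \<inter> W) \<union> f ` A" if "i \<in> J" for i
        using s'_cases[OF that] t'_cases[OF that] stT[OF that] by auto
      then show ?thesis by blast
    qed
    then have "card (s' ` J \<union> t' ` J) \<le> card ((T \<inter> W) \<union> f ` A)"
      using finT finA by (intro card_mono) auto
    also have "\<dots> \<le> card (T \<inter> W) + card (f ` A)" by (rule card_Un_le)
    also have "\<dots> \<le> card (T \<inter> W) + card (T - W)"
      using card_image_le[OF finA, of f] card_mono[OF _ AT] finT by force
    also have "\<dots> = card T"
      using finT by (metis card_Int_Diff)
    finally show ?thesis .
  qed
  ultimately have "linked_pairs W F J s' t'"
    using sub unfolding T_def by blast
  then obtain L' where
    all_L': "\<forall>i\<in>J. is_path W F (L' i) \<and> hd (L' i) = s' i \<and> last (L' i) = t' i"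
    and all_dL': "\<forall>i\<in>J. \<forall>j\<in>J. i \<noteq> j \<longrightarrow> set (L' i) \<inter> set (L' j) = {}"
    unfolding linked_pairs_def by (elim exE conjE)
  have L': "is_path W F (L' i) \<and> hd (L' i) = s' i \<and> last (L' i) = t' i" if "i \<in> J" for i
    using all_L' that by (rule bspec)
  have dL': "set (L' i) \<inter> set (L' j) = {}" if "i \<in> J" "j \<in> J" "i \<noteq> j" for i j
    using all_dL'[rule_format, OF that] .
  \<comment> \<open>Outside \<open>D\<close>, an end lying outside \<open>W\<close> is attached to
    the path in \<open>W\<close> by the edge along which it was moved.\<close>
  define L where "L i = (if i \<in> D then (if s i = t i then [s i] else [s i, t i])
      else (if s i \<in> W then [] else [s i]) @ L' i @ (if t i \<in> W then [] else [t i]))" for i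
  have "is_path V E (L i) \<and> hd (L i) = s i \<and> last (L i) = t i" if i: "i \<in> I" for i
  proof (cases "i \<in> D")
    case True
    then show ?thesis
      using stV[OF i] by (auto simp: L_def D_def intro!: is_path_Cons is_path_singleton)
  next
    case False
    then have iJ: "i \<in> J" using i by (simp add: J_def)
    note p = L'[OF iJ]
    have ne: "L' i \<noteq> []" and sW: "set (L' i) \<subseteq> W"
      using p by (auto simp: is_path_def)
    have pV: "is_path V E (L' i)" using p W F is_path_mono by blast
    \<comment> \<open>Equal ends outside \<open>W\<close> would put \<open>i\<close> into
      \<open>D\<close>; so prepending \<open>s i\<close> cannot repeat the vertex
      \<open>t i\<close>.\<close>
    have st_ne: "s i \<noteq> t i" if "s i \<notin> W"
      using False i that by (auto simp: D_def)
    have sE: "if s i \<in> W then s' i = s i else {s i, s' i} \<in> E"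
      using fA(3)[of "s i"] iJ by (auto simp: s'_def move_def A_def stuck_def)
    have tE: "if t i \<in> W then t' i = t i else {t i, t' i} \<in> E"
      using fA(3)[of "t i"] iJ by (auto simp: t'_def move_def A_def stuck_def)
    define q where "q = L' i @ (if t i \<in> W then [] else [t i])"
    have q: "is_path V E q" "hd q = s' i" "last q = t i" "set q \<subseteq> W \<union> {t i}" "q \<noteq> []"
      using pV p tE sW stV[OF i] ne by (auto simp: q_def intro!: is_path_snoc)
    have "is_path V E (s i # q)" if "s i \<notin> W"
      using q that st_ne[OF that] sE stV[OF i] by (intro is_path_Cons) auto
    then show ?thesis
      using q sE False by (auto simp: L_def q_def[symmetric])
  qed
  \<comment> \<open>The paths are compared separately inside and outside \<open>W\<close>: inside
    only the vertices of \<open>L'\<close> occur, outside only the pair's own terminals.\<close>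
  moreover have "set (L i) \<inter> set (L j) = {}" if ij: "i \<in> I" "j \<in> I" "i \<noteq> j" for i j
  proof -
    have *: "set (L i) \<subseteq> ({s i, t i} - W) \<union> (if i \<in> J then set (L' i) else {})" if "i \<in> I" for i
      using that by (auto simp: L_def D_def J_def split: if_splits)
    have sW: "set (L' i) \<subseteq> W" if "i \<in> J" for i
      using L'[OF that] by (auto simp: is_path_def)
    have **: "set (L i) \<inter> W \<subseteq> (if i \<in> J then set (L' i) else {})"
        "set (L i) - W \<subseteq> {s i, t i}" if "i \<in> I" for i
      using *[OF that] sW[of i] by (auto split: if_splits)
    have "set (L i) \<inter> W \<inter> (set (L j) \<inter> W) = {}"
      using **(1)[OF ij(1)] **(1)[OF ij(2)] dL'[of i j] ij(3) by (auto split: if_splits)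
    moreover have "(set (L i) - W) \<inter> (set (L j) - W) = {}"
      using **(2)[OF ij(1)] **(2)[OF ij(2)] apart[OF ij] by blast
    ultimately show ?thesis by blast
  qed
  ultimately show ?thesis
    unfolding linked_pairs_def by blast
qed

section \<open>Graphs of polytopes\<close>

lemma finite_vertices: "polytope P \<Longrightarrow> finite (vertices P)"
  unfolding polytope_def vertices_def
  by (metis extreme_points_of_convex_hull finite_subset)

lemma convex_hull_vertices: "polytope P \<Longrightarrow> convex hull (vertices P) = P"
  unfolding vertices_def
  using Krein_Milman_Minkowski polytope_imp_compact polytope_imp_convex by blast

lemma aff_dim_vertices: "polytope P \<Longrightarrow> aff_dim (vertices P) = aff_dim P"
  by (metis aff_dim_convex_hull convex_hull_vertices)

lemma aff_dim_less_card_vertices: "polytope P \<Longrightarrow> aff_dim P < int (card (vertices P))"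
  using aff_dim_le_card[OF finite_vertices] aff_dim_vertices by fastforce

lemma vertices_face: "F face_of P \<Longrightarrow> vertices F = vertices P \<inter> F"
  by (auto simp: vertices_def extreme_point_of_face)

lemma in_edges_iff: "{u, v} \<in> edges P \<longleftrightarrow> closed_segment u v edge_of P"
  unfolding edges_def by (auto simp: doubleton_eq_iff closed_segment_commute)

lemma edges_face: "F face_of P \<Longrightarrow> edges F \<subseteq> edges P"
  unfolding edges_def edge_of_def using face_of_trans by blast

lemma edge_ends:
  assumes "{u, v} \<in> edges P"
  shows "v \<in> vertices P" "v \<noteq> u"
proof -
  have e: "closed_segment u v face_of P" "aff_dim (closed_segment u v) = 1"
    using assms by (auto simp: in_edges_iff edge_of_def)
  show "v \<in> vertices P"
    using extreme_point_of_face[OF e(1), of v] by (simp add: vertices_def extreme_point_of_segment)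
  show "v \<noteq> u" using e(2) by auto
qed

section \<open>Facets through a vertex, the degree bound and non-simplices\<close>

text \<open>The proper face \<open>{w}\<close> is the intersection of the facets containing it, so
  one of these facets must exclude \<open>v\<close>.\<close>

lemma facet_avoiding_vertex:
  assumes P: "polytope P" and v: "v \<in> vertices P" and w: "w \<in> vertices P" "v \<noteq> w"
  obtains F where "F facet_of P" "w \<in> F" "v \<notin> F"
proof -
  have "{w} face_of P" using w(1) by (simp add: vertices_def face_of_singleton)
  moreover have "{w} \<noteq> P"
    using v w(2) by (auto simp: vertices_def extreme_point_of_def)
  ultimately have "{w} = \<Inter>{F. F facet_of P \<and> {w} \<subseteq> F}"
    using P by (intro face_of_polyhedron) (auto simp: polytope_imp_polyhedron)
  then show ?thesis using that w(2) by blast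
qed

text \<open>By induction, the affine hull contains every facet through \<open>v\<close>. In dimension at
  least 2 there are two such facets, and together they span \<open>P\<close>.\<close>

lemma polytope_subset_affine_hull_neighbours:
  assumes "polytope P" "v \<in> vertices P"
  shows "P \<subseteq> affine hull (insert v {w. {v, w} \<in> edges P})"
  using assms
proof (induction "nat (aff_dim P)" arbitrary: P rule: less_induct)
  case less
  note P = less.prems(1) and v = less.prems(2)
  define A where "A = affine hull (insert v {w. {v, w} \<in> edges P})"
  have vP: "v \<in> P" using v by (auto simp: vertices_def extreme_point_of_def)
  have cvx: "convex P" using P polytope_imp_convex by blast
  have "P \<subseteq> A"
  proof (cases "aff_dim P \<le> 1")
    case True
    then have "collinear P" by (simp add: collinear_aff_dim)
    then obtain a b where ab: "P = closed_segment a b"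
      using compact_convex_collinear_segment P vP polytope_imp_compact cvx by blast
    then have "v = a \<or> v = b"
      using v by (simp add: vertices_def extreme_point_of_segment)
    then obtain w where w: "P = closed_segment v w"
      using ab closed_segment_commute by blast
    show ?thesis
    proof (cases "v = w")
      case True
      then show ?thesis using w by (simp add: A_def hull_inc)
    next
      case False
      then have "aff_dim P = 1"
        unfolding w by (simp add: segment_convex_hull aff_dim_convex_hull)
      then have "{v, w} \<in> edges P"
        using cvx by (simp add: in_edges_iff edge_of_def face_of_refl flip: w)
      then have "{v, w} \<subseteq> A" by (auto simp: A_def intro: hull_inc)
      then have "convex hull {v, w} \<subseteq> A"
        by (simp add: A_def affine_imp_convex hull_minimal)
      then show ?thesis by (simp add: w segment_convex_hull)
    qed
  next
    case False
    have facet: "F \<subseteq> A" if F: "F facet_of P" "v \<in> F" for F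
    proof -
      have f: "F face_of P" using F(1) by (rule facet_of_imp_face_of)
      have "v \<in> vertices F" using vertices_face[OF f] v F(2) by simp
      moreover have "nat (aff_dim F) < nat (aff_dim P)"
        using F(1) False by (simp add: facet_of_def)
      moreover have "polytope F" using P f face_of_polytope_polytope by blast
      ultimately have "F \<subseteq> affine hull (insert v {w. {v, w} \<in> edges F})"
        using less.hyps by blast
      also have "\<dots> \<subseteq> A"
        unfolding A_def using edges_face[OF f] by (intro hull_mono) blast
      finally show ?thesis .
    qed
    have "{v} face_of P" using v by (simp add: vertices_def face_of_singleton)
    moreover have v_ne: "{v} \<noteq> P" using False by auto
    ultimately have v_eq: "{v} = \<Inter>{F. F facet_of P \<and> {v} \<subseteq> F}"
      using P by (intro face_of_polyhedron) (auto simp: polytope_imp_polyhedron)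
    obtain z where "z \<noteq> v" "z \<in> P" using v_ne vP by blast
    then obtain F where F: "F facet_of P" "v \<in> F" using v_eq by blast
    have Fdim: "aff_dim F = aff_dim P - 1" using F(1) by (simp add: facet_of_def)
    \<comment> \<open>Since \<open>F\<close> has dimension at least 1, it has a point
      \<open>x\<close> other than \<open>v\<close>. The facets through \<open>v\<close> meet only in
      \<open>v\<close>, so one of them, \<open>F'\<close>, misses \<open>x\<close>.\<close>
    then have "F \<noteq> {v}" using False by auto
    then obtain x where x: "x \<in> F" "x \<noteq> v" using F(2) by blast
    then obtain F' where F': "F' facet_of P" "v \<in> F'" "x \<notin> F'"
      using v_eq by blast
    have F'dim: "aff_dim F' = aff_dim P - 1" using F'(1) by (simp add: facet_of_def)
    have f': "F' face_of P" using F'(1) by (rule facet_of_imp_face_of)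
    have "x \<in> P" using x F(1) facet_of_imp_subset by blast
    then have "x \<notin> affine hull F'"
      using face_of_imp_eq_affine_Int[OF cvx f'] F'(3) by blast
    \<comment> \<open>A single point outside the affine hull of the facet \<open>F'\<close> raises
      its dimension to that of \<open>P\<close>; a subset of \<open>P\<close> of the same dimension
      has the same affine hull.\<close>
    then have "aff_dim (insert x F') = aff_dim P"
      using F'dim by (simp add: aff_dim_insert)
    moreover have "insert x F' \<subseteq> A" using facet[OF F] facet[OF F'(1,2)] x by blast
    moreover have "insert x F' \<subseteq> P" using \<open>x \<in> P\<close> F'(1) facet_of_imp_subset by blast
    ultimately have "affine hull (insert x F') = affine hull P" "affine hull (insert x F') \<subseteq> A"
      by (simp_all add: aff_dim_eq_full_gen[symmetric] A_def hull_minimal)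
    then show ?thesis using hull_subset[of P affine] by blast
  qed
  then show ?case by (simp add: A_def)
qed

text \<open>Together \<open>v\<close> and its neighbours affinely span \<open>P\<close>, which takes
  at least \<open>aff_dim P + 1\<close> points, one of them being \<open>v\<close>.\<close>

lemma aff_dim_le_degree:
  assumes P: "polytope P" and v: "v \<in> vertices P"
  shows "aff_dim P \<le> int (card {w \<in> vertices P - {v}. {v, w} \<in> edges P})"
proof -
  have eq: "{w \<in> vertices P - {v}. {v, w} \<in> edges P} = {w. {v, w} \<in> edges P}" (is "_ = ?N")
    using edge_ends by fast
  have "finite ?N"
    using finite_vertices[OF P] edge_ends(1) by (rule_tac finite_subset) auto
  moreover have "v \<notin> ?N" using edge_ends(2) by blast
  moreover have "aff_dim P \<le> aff_dim (insert v ?N)"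
    using polytope_subset_affine_hull_neighbours[OF P v] aff_dim_subset aff_dim_affine_hull by metis
  ultimately show ?thesis
    unfolding eq using aff_dim_le_card[of "insert v ?N"] by simp
qed

text \<open>With this many vertices some \<open>v\<close> is an affine combination of the others. A
  facet avoiding \<open>v\<close> cannot contain all the others, since its affine hull would then
  contain \<open>v\<close>, and that hull meets \<open>P\<close> only in the facet.\<close>

lemma facet_missing_two_vertices:
  assumes P: "polytope P" and many: "aff_dim P + 1 < int (card (vertices P))"
  obtains F where "F facet_of P" "card (vertices F) + 2 \<le> card (vertices P)"
proof -
  have fin: "finite (vertices P)" using finite_vertices[OF P] .
  have "affine_dependent (vertices P)"
    using many aff_dim_affine_independent aff_dim_vertices[OF P] by force
  then obtain v where v: "v \<in> vertices P" "v \<in> affine hull (vertices P - {v})"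
    unfolding affine_dependent_def by blast
  then have "vertices P - {v} \<noteq> {}" by (metis affine_hull_eq_empty empty_iff)
  then obtain w where "w \<in> vertices P" "v \<noteq> w" by blast
  then obtain F where F: "F facet_of P" "v \<notin> F"
    using facet_avoiding_vertex[OF P v(1)] by blast
  have f: "F face_of P" using F(1) by (rule facet_of_imp_face_of)
  have "v \<in> P" using v(1) by (auto simp: vertices_def extreme_point_of_def)
  then have "v \<notin> affine hull F"
    using face_of_imp_eq_affine_Int[OF polytope_imp_convex[OF P] f] F(2) by blast
  then have "\<not> vertices P - {v} \<subseteq> F" using v(2) hull_mono by blast
  then obtain u where u: "u \<in> vertices P" "u \<noteq> v" "u \<notin> F" by blast
  have "vertices F \<subseteq> vertices P - {u, v}"
    using vertices_face[OF f] F(2) u(3) by blast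
  then have "card (vertices F) \<le> card (vertices P - {u, v})"
    using fin by (intro card_mono) auto
  also have "\<dots> = card (vertices P) - 2"
    using u v(1) fin by (subst card_Diff_subset) auto
  finally have "card (vertices F) \<le> card (vertices P) - 2" .
  moreover have "2 \<le> card (vertices P)"
    using card_mono[OF fin, of "{u, v}"] u v(1) by simp
  ultimately show ?thesis using that[OF F(1)] by linarith
qed

section \<open>Induction on the dimension and the bound on linkedness\<close>

text \<open>Passing to a facet lowers \<open>2 * d + 2\<close> by 2, which is paid for by the two
  vertices that the facet misses; the number of terminals does not grow.\<close>

lemma polytope_linked_pairs:
  fixes s t :: "'i \<Rightarrow> 'a::euclidean_space"
  assumes "polytope P" "aff_dim P = int d"
    and "card (vertices P) + card (s ` I \<union> t ` I) \<le> 2 * d + 2"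
    and "disjoint_pairs (vertices P) I s t"
  shows "linked_pairs (vertices P) (edges P) I s t"
  using assms
proof (induction d arbitrary: P I s t rule: less_induct)
  case (less d)
  note P = less.prems(1) and dim = less.prems(2) and few = less.prems(3) and st = less.prems(4)
  have fin: "finite (vertices P)" using finite_vertices[OF P] .
  have deg: "d \<le> card {w \<in> vertices P - {v}. {v, w} \<in> edges P}" if "v \<in> vertices P" for v
    using aff_dim_le_degree[OF P that] dim by linarith
  show ?case
  proof (cases "card (vertices P) = d + 1")
    case True
    \<comment> \<open>A degree of at least \<open>d\<close> leaves no nonneighbour among the
      \<open>d\<close> other vertices.\<close>
    have "{u, v} \<in> edges P" if "u \<in> vertices P" "v \<in> vertices P" "u \<noteq> v" for u v
    proof -
      have "{w \<in> vertices P - {u}. {u, w} \<in> edges P} = vertices P - {u}"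
        using deg[OF that(1)] fin that(1) True by (intro card_seteq) auto
      then show ?thesis using that by blast
    qed
    then show ?thesis
      using st by (intro linked_pairs_adjacent) (auto simp: disjoint_pairs_def)
  next
    case False
    then have many: "aff_dim P + 1 < int (card (vertices P))"
      using aff_dim_less_card_vertices[OF P] dim by linarith
    then obtain F where F: "F facet_of P" "card (vertices F) + 2 \<le> card (vertices P)"
      using facet_missing_two_vertices[OF P] by blast
    have f: "F face_of P" using F(1) by (rule facet_of_imp_face_of)
    have pF: "polytope F" using P f face_of_polytope_polytope by blast
    \<comment> \<open>Facets are nonempty by definition. This forces \<open>d > 0\<close>, so that
      \<open>d - 1\<close> is a genuine predecessor; dimension 0 belongs to the complete case
      above.\<close>
    have "0 \<le> aff_dim F"
      using F(1) aff_dim_negative_iff[of F] unfolding facet_of_def by linarith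
    then have dF: "aff_dim F = int (d - 1)" "0 < d"
      using F(1) dim by (auto simp: facet_of_def)
    have dW: "d \<le> card (vertices F)"
      using aff_dim_less_card_vertices[OF pF] dF by linarith
    show ?thesis
    proof (rule linked_pairs_via_subgraph[OF fin _ edges_face[OF f] deg few dW st])
      fix J :: "'i set" and s' t'
      assume J: "disjoint_pairs (vertices F) J s' t'"
        "card (s' ` J \<union> t' ` J) \<le> card (s ` I \<union> t ` I)"
      have "card (vertices F) + card (s' ` J \<union> t' ` J) \<le> 2 * (d - 1) + 2"
        using J(2) few F(2) dF(2) by linarith
      then show "linked_pairs (vertices F) (edges F) J s' t'"
        using less.IH[OF _ pF dF(1) _ J(1)] dF(2) by simp
    qed (use vertices_face[OF f] in auto)
  qed
qed

lemma polytope_linked_few_vertices: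
  assumes P: "polytope P" "aff_dim P = int d"
    and few: "card (vertices P) + 2 * k \<le> 2 * d + 2"
  shows "polytope_linked k P"
  unfolding polytope_linked_def graph_linked_def
proof (intro conjI allI impI)
  \<comment> \<open>There are at least \<open>d + 1\<close> vertices, so
    \<open>2 * d + 2 - card (vertices P)\<close> is at most
    \<open>card (vertices P)\<close>.\<close>
  show "2 * k \<le> card (vertices P)"
    using few aff_dim_less_card_vertices[OF P(1)] P(2) by linarith
  fix s t :: "nat \<Rightarrow> 'a"
  assume st: "s ` {..<k} \<subseteq> vertices P \<and> t ` {..<k} \<subseteq> vertices P \<and>
            inj_on s {..<k} \<and> inj_on t {..<k} \<and> s ` {..<k} \<inter> t ` {..<k} = {}"
  have "card (s ` {..<k} \<union> t ` {..<k}) \<le> k + k"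
    using card_Un_le[of "s ` {..<k}" "t ` {..<k}"] card_image_le[of "{..<k}" s]
      card_image_le[of "{..<k}" t] by simp
  moreover have "disjoint_pairs (vertices P) {..<k} s t"
    using st unfolding disjoint_pairs_def inj_on_def by blast
  ultimately have "linked_pairs (vertices P) (edges P) {..<k} s t"
    using few by (intro polytope_linked_pairs[OF P]) auto
  then show "\<exists>L. (\<forall>i<k. is_path (vertices P) (edges P) (L i) \<and> hd (L i) = s i \<and> last (L i) = t i) \<and>
           (\<forall>i<k. \<forall>j<k. i \<noteq> j \<longrightarrow> set (L i) \<inter> set (L j) = {})"
    by (simp add: linked_pairs_def Ball_def)
qed

theorem theorem3p3:
  fixes d \<gamma> :: nat
  assumes "\<gamma> \<le> d"
  shows "class_linkedness TYPE('a::euclidean_space) d \<gamma> \<ge> enat ((d - \<gamma> + 1) div 2)"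
proof -
  define k where "k = (d - \<gamma> + 1) div 2"
  have "k \<le> linkedness P" if "P \<in> polytope_class d \<gamma>" for P :: "'a set"
  proof -
    have P: "polytope P" "aff_dim P = int d" "card (vertices P) = d + \<gamma> + 1"
      using that by (auto simp: polytope_class_def)
    \<comment> \<open>Here \<open>2 * k <= d - \<gamma> + 1\<close>, and adding the
      \<open>d + \<gamma> + 1\<close> vertices gives at most \<open>2 * d + 2\<close>.\<close>
    have "card (vertices P) + 2 * k \<le> 2 * d + 2"
      using P(3) assms by (simp add: k_def)
    then have "polytope_linked k P"
      using polytope_linked_few_vertices P by blast
    then show ?thesis
      unfolding linkedness_def using finite_linked by (intro Max_ge) auto
  qed
  \<comment> \<open>The number \<open>k\<close> is a member of the set whose supremum is taken,
    which also settles the case of an empty class.\<close>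
  then show ?thesis
    unfolding class_linkedness_def k_def[symmetric] by (intro Sup_upper) blast
qed

end
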